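(* Let $\mu$ be a positive Borel measure on $[0,1)$ with $\int_{[0,1)}\log\frac{2}{1-t}\,d\mu(t)<\infty$. Then the following three conditions are equivalent: (i) The measure $\nu$ on $[0,1)$ defined by $d\nu(t)=\log\frac{2}{1-t}\,d\mu(t)$ is a Carleson measure. (ii) The operator $I_\mu$ is bounded from $\mathcal B$ into $BMOA$. (iii) The operator $I_\mu$ is bounded from $BMOA$ into itself.
   Context: $\mathbb D=\{z\in\mathbb C:|z|<1\}$. The Bloch space $\mathcal B$ is the set of analytic functions $f$ in $\mathbb D$ with $\|f\|_{\mathcal B}=|f(0)|+\sup_{z\in\mathbb D}(1-|z|^2)|f'(z)|<\infty$. For $a\in\mathbb D$ let $\varphi_a(z)=\frac{a-z}{1-\overline a z}$; $BMOA$ is the set of analytic functions $f$ in $\mathbb D$ with $\|f\|_{BMOA}=|f(0)|+\sup_{a\in\mathbb D}\|f\circ\varphi_a-f(a)\|_{H^2}<\infty$, where $H^2$ is the Hardy space. The operator $I_\mu$ is given by $I_\mu(f)(z)=\int_{[0,1)}\frac{f(t)}{1-tz}\,d\mu(t)$, $z\in\mathbb D$ (under the integrability hypothesis on $\mu$ it is well defined, with analytic values, for all $f\in\mathcal B$, and $BMOA\subset\mathcal B$). A positive Borel measure $\nu$ on $[0,1)$ is a Carleson measure if there is $C>0$ with $\nu([t,1))\le C(1-t)$ for all $0\le t<1$. *)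

theory Defs
  imports "HOL-Complex_Analysis.Complex_Analysis"
begin

text \<open>
  Analytic functions on the unit disc are total functions of type
  \<^typ>\<open>complex \<Rightarrow> complex\<close> that are holomorphic on \<^term>\<open>ball 0 1 :: complex set\<close>; all norms below
  depend only on the values in that open disc.  The norms take values in \<^typ>\<open>ennreal\<close>, so that
  the supremum of an unbounded family is \<open>\<infinity>\<close> and each space is the set of analytic functions
  of finite norm.
\<close>

definition bloch_norm :: "(complex \<Rightarrow> complex) \<Rightarrow> ennreal" where
  "bloch_norm f = ennreal (cmod (f 0)) +
     (SUP z\<in>ball 0 1. ennreal ((1 - (cmod z)\<^sup>2) * cmod (deriv f z)))"

definition Bloch :: "(complex \<Rightarrow> complex) set" where
  "Bloch = {f. f holomorphic_on ball 0 1 \<and> bloch_norm f < \<infinity>}"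

text \<open>Only used for functions that are analytic in the disc, so the integrands are continuous.\<close>

definition hardy2_norm :: "(complex \<Rightarrow> complex) \<Rightarrow> ennreal" where
  "hardy2_norm f = (SUP r\<in>{0<..<1::real}.
     ennreal (sqrt (1 / (2 * pi) * integral {0..2*pi} (\<lambda>\<theta>. (cmod (f (of_real r * cis \<theta>)))\<^sup>2))))"

definition disc_aut :: "complex \<Rightarrow> complex \<Rightarrow> complex" where
  "disc_aut a z = (a - z) / (1 - cnj a * z)"

definition bmoa_norm :: "(complex \<Rightarrow> complex) \<Rightarrow> ennreal" where
  "bmoa_norm f = ennreal (cmod (f 0)) +
     (SUP a\<in>ball 0 1. hardy2_norm (\<lambda>z. f (disc_aut a z) - f a))"

definition BMOA :: "(complex \<Rightarrow> complex) set" where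
  "BMOA = {f. f holomorphic_on ball 0 1 \<and> bmoa_norm f < \<infinity>}"

definition borel_measure_on_unit :: "real measure \<Rightarrow> bool" where
  "borel_measure_on_unit M \<longleftrightarrow> sets M = sets (restrict_space borel {0..<1})"

definition carleson_measure :: "real measure \<Rightarrow> bool" where
  "carleson_measure N \<longleftrightarrow> borel_measure_on_unit N \<and>
     (\<exists>C>0. \<forall>t\<in>{0..<1}. emeasure N {t..<1} \<le> ennreal (C * (1 - t)))"

definition I_op :: "real measure \<Rightarrow> (complex \<Rightarrow> complex) \<Rightarrow> complex \<Rightarrow> complex" where
  "I_op M f z = (LINT t|M. f (of_real t) / (1 - of_real t * z))"

definition bounded_between ::
  "(complex \<Rightarrow> complex) set \<Rightarrow> ((complex \<Rightarrow> complex) \<Rightarrow> ennreal) \<Rightarrow>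
   (complex \<Rightarrow> complex) set \<Rightarrow> ((complex \<Rightarrow> complex) \<Rightarrow> ennreal) \<Rightarrow>
   ((complex \<Rightarrow> complex) \<Rightarrow> complex \<Rightarrow> complex) \<Rightarrow> bool" where
  "bounded_between X nX Y nY T \<longleftrightarrow>
     (\<exists>C\<ge>0. \<forall>f\<in>X. T f \<in> Y \<and> nY (T f) \<le> ennreal C * nX f)"

end

theory Submission
  imports Defs
begin

text \<open>
  Write \<open>L t = ln (2 / (1 - t))\<close> and \<open>\<nu>\<close> for the measure with density \<open>L\<close> with respect to \<open>\<mu>\<close>.  The proof
  rests on one sufficient condition for BMOA: a holomorphic \<open>F\<close> with \<open>\<bar>F' z\<bar> \<le> C / \<bar>1 - z\<bar>\<close> in the disc
  belongs to BMOA, with a seminorm at most a constant times \<open>C\<close> (\<open>bmoa_norm_le\<close>).  The functions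
  \<open>F \<circ> \<phi>\<^sub>a - F a\<close> have derivatives dominated by two Cauchy kernels, hence square means of order
  \<open>1 / (1 - r\<^sup>2)\<close> on the circle of radius \<open>r\<close> (\<open>hardy2_norm_composition_le\<close>), and a coefficientwise
  integration in \<open>r\<close> turns that into a bound for the Hardy norm (\<open>hardy2_norm_le_of_deriv\<close>).

  If \<open>\<nu>\<close> is a Carleson measure and \<open>f\<close> is a Bloch function of norm \<open>B\<close>, then \<open>\<bar>f t\<bar> \<le> 2 * B * L t\<close>, so
  \<open>\<bar>(I_op \<mu> f)' z\<bar>\<close> is at most \<open>2 * B\<close> times the integral of \<open>1 / \<bar>1 - t * z\<bar>\<^sup>2\<close> against \<open>\<nu>\<close>.
  A dyadic decomposition shows that this integral is \<open>O(1 / \<bar>1 - z\<bar>)\<close> (\<open>carleson_kernel_bound\<close>),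
  and the sufficient condition applies.  Thus the operator is bounded from the Bloch space to BMOA.
  It is then bounded on BMOA, because the BMOA norm dominates the Bloch norm
  (\<open>bloch_norm_le_bmoa_norm\<close>).

  If the operator is bounded on BMOA, it is applied to \<open>log (2 / (1 - z))\<close>, which satisfies the
  sufficient condition and equals \<open>L\<close> on the interval.  The image \<open>F\<close> lies in BMOA, hence in the Bloch
  space, and \<open>F' x\<close> is the integral of \<open>t / (1 - t * x)\<^sup>2\<close> against \<open>\<nu>\<close>.  The part of this integral over
  \<open>{x..<1}\<close> is at least of order \<open>\<nu> {x..<1} / (1 - x)\<^sup>2\<close>, whereas the Bloch condition makes \<open>F' x\<close> at
  most of order \<open>1 / (1 - x)\<close>; this is the Carleson condition (\<open>log_weight_tail_le\<close>).
\<close>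

section \<open>Parseval's identity on circles\<close>

lemma has_integral_cis_multiple:
  fixes k :: int
  shows "((\<lambda>\<theta>. cis (of_int k * \<theta>)) has_integral (if k = 0 then 2 * pi else 0)) {0..2*pi}"
proof (cases "k = 0")
  case True
  then show ?thesis
    using has_integral_const_real[of "1::complex" 0 "2*pi"] by (simp add: scaleR_conv_of_real)
next
  case False
  let ?F = "\<lambda>\<theta>. cis (of_int k * \<theta>) / (\<i> * of_int k)"
  have "((\<lambda>\<theta>. cis (of_int k * \<theta>)) has_integral ?F (2*pi) - ?F 0) {0..2*pi}"
  proof (rule fundamental_theorem_of_calculus)
    fix x :: real
    have "((\<lambda>w. exp (\<i> * of_int k * w) / (\<i> * of_int k)) has_field_derivative
       exp (\<i> * of_int k * of_real x)) (at (of_real x))"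
      using False by (auto intro!: derivative_eq_intros)
    then have "((\<lambda>\<theta>. exp (\<i> * of_int k * of_real \<theta>) / (\<i> * of_int k)) has_vector_derivative
       exp (\<i> * of_int k * of_real x)) (at x within {0..2*pi})"
      by (rule has_vector_derivative_real_field)
    then show "(?F has_vector_derivative cis (of_int k * x)) (at x within {0..2*pi})"
      by (simp add: cis_conv_exp mult.assoc)
  qed auto
  moreover have "cis (of_int k * (2*pi)) = 1"
    using cis_multiple_2pi[of "of_int k"] by (simp add: mult_ac)
  ultimately show ?thesis using False by simp
qed

text \<open>
  Only the orthogonality of the characters is at work here: expanding the square as
  \<open>S * cnj S\<close> leaves, after integration, the diagonal terms.
\<close>

lemma parseval_trigonometric_polynomial:
  fixes c :: "nat \<Rightarrow> complex" and r :: real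
  shows "((\<lambda>\<theta>. (cmod (\<Sum>n<N. c n * (of_real r * cis \<theta>) ^ n))\<^sup>2)
     has_integral 2 * pi * (\<Sum>n<N. (cmod (c n))\<^sup>2 * r ^ (2 * n))) {0..2*pi}"
proof -
  let ?S = "\<lambda>\<theta>. \<Sum>n<N. c n * (of_real r * cis \<theta>) ^ n"
  let ?a = "\<lambda>m n. c m * cnj (c n) * of_real (r ^ m * r ^ n)"
  have product_term: "c m * (of_real r * cis \<theta>) ^ m * cnj (c n * (of_real r * cis \<theta>) ^ n)
     = ?a m n * cis (of_int (int m - int n) * \<theta>)" for m n \<theta>
  proof -
    have "cis (of_int (int m - int n) * \<theta>) = cis (real m * \<theta>) * cnj (cis (real n * \<theta>))"
      by (simp add: cis_cnj cis_mult left_diff_distrib)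
    moreover have "(of_real r * cis \<theta>) ^ k = of_real (r ^ k) * cis (real k * \<theta>)" for k
      unfolding power_mult_distrib Complex.DeMoivre of_real_power ..
    ultimately show ?thesis
      by (simp only: complex_cnj_mult complex_cnj_complex_of_real of_real_mult mult.assoc mult.left_commute mult.commute)
  qed
  have expand: "?S \<theta> * cnj (?S \<theta>) = (\<Sum>m<N. \<Sum>n<N. ?a m n * cis (of_int (int m - int n) * \<theta>))" for \<theta>
    unfolding cnj_sum sum_product product_term ..
  have "((\<lambda>\<theta>. \<Sum>m<N. \<Sum>n<N. ?a m n * cis (of_int (int m - int n) * \<theta>)) has_integral
      (\<Sum>m<N. \<Sum>n<N. ?a m n * (if int m - int n = 0 then 2 * pi else 0))) {0..2*pi}"
    by (intro has_integral_sum finite_lessThan) (rule has_integral_mult_right[OF has_integral_cis_multiple])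
  also have "(\<Sum>m<N. \<Sum>n<N. ?a m n * (if int m - int n = 0 then 2 * pi else 0))
      = (\<Sum>m<N. ?a m m * (2 * pi))"
  proof (intro sum.cong refl)
    fix m assume "m \<in> {..<N}"
    have "(\<Sum>n<N. ?a m n * (if int m - int n = 0 then 2 * pi else 0))
       = (\<Sum>n<N. if n = m then ?a m m * (2 * pi) else 0)"
      by (intro sum.cong refl) auto
    then show "(\<Sum>n<N. ?a m n * (if int m - int n = 0 then 2 * pi else 0)) = ?a m m * (2 * pi)"
      using \<open>m \<in> {..<N}\<close> by simp
  qed
  also have "\<dots> = of_real (2 * pi * (\<Sum>n<N. (cmod (c n))\<^sup>2 * r ^ (2 * n)))"
    unfolding complex_norm_square[symmetric] power_add[symmetric] mult_2[symmetric]
      of_real_mult[symmetric] of_real_sum[symmetric] sum_distrib_left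
    by (simp only: mult.assoc mult.left_commute mult.commute)
  finally have "((\<lambda>\<theta>. ?S \<theta> * cnj (?S \<theta>)) has_integral
     of_real (2 * pi * (\<Sum>n<N. (cmod (c n))\<^sup>2 * r ^ (2 * n)))) {0..2*pi}"
    unfolding expand .
  then have "((\<lambda>\<theta>. Re (?S \<theta> * cnj (?S \<theta>))) has_integral
      Re (of_real (2 * pi * (\<Sum>n<N. (cmod (c n))\<^sup>2 * r ^ (2 * n))))) {0..2*pi}"
    by (rule has_integral_linear[OF _ bounded_linear_Re, unfolded o_def])
  then show ?thesis by (simp only: complex_norm_square[symmetric] Re_complex_of_real)
qed

text \<open>
  The quantity under the square root in the definition of the Hardy norm, so that
  \<open>hardy2_norm f\<close> is the supremum of \<open>sqrt (circle_mean f r)\<close>.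
\<close>

definition circle_mean :: "(complex \<Rightarrow> complex) \<Rightarrow> real \<Rightarrow> real" where
  "circle_mean f r = 1 / (2 * pi) * integral {0..2*pi} (\<lambda>\<theta>. (cmod (f (of_real r * cis \<theta>)))\<^sup>2)"

definition taylor_coeff :: "(complex \<Rightarrow> complex) \<Rightarrow> nat \<Rightarrow> complex" where
  "taylor_coeff f n = (deriv ^^ n) f 0 / fact n"

lemma taylor_sums:
  assumes "f holomorphic_on ball 0 1" "cmod z < 1"
  shows "(\<lambda>n. taylor_coeff f n * z ^ n) sums f z"
  using holomorphic_power_series[OF assms(1), of z] assms(2) by (simp add: taylor_coeff_def)

lemma taylor_coeff_deriv: "taylor_coeff (deriv f) n = of_nat (Suc n) * taylor_coeff f (Suc n)"
proof -
  have "(deriv ^^ n) (deriv f) = (deriv ^^ Suc n) f"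
    by (simp add: funpow_swap1)
  then show ?thesis
    by (simp add: taylor_coeff_def del: funpow.simps of_nat_Suc)
qed

text \<open>
  The coefficients are arbitrary, so that besides Taylor series the geometric series of the
  Cauchy kernel is covered without computing its higher derivatives.  The partial sums are bounded
  on the circle by the sum of the absolute values, so the polynomial case passes to the limit by
  dominated convergence.
\<close>

lemma parseval_circle:
  assumes f: "\<And>z. cmod z < 1 \<Longrightarrow> (\<lambda>n. c n * z ^ n) sums f z" and r: "0 \<le> r" "r < 1"
  shows "(\<lambda>n. (cmod (c n))\<^sup>2 * r ^ (2 * n)) sums circle_mean f r"
proof -
  let ?S = "\<lambda>N \<theta>. \<Sum>n<N. c n * (of_real r * cis \<theta>) ^ n"
  let ?M = "\<Sum>n. cmod (c n * of_real r ^ n)"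
  have summable: "summable (\<lambda>n. cmod (c n * of_real r ^ n))"
  proof (rule powser_insidea)
    show "summable (\<lambda>n. c n * of_real ((1 + r) / 2) ^ n)"
      using f[of "of_real ((1 + r) / 2)"] r by (intro sums_summable) (simp add: norm_of_real del: of_real_add of_real_divide)
    show "cmod (of_real r) < cmod (of_real ((1 + r) / 2))"
      using r unfolding norm_of_real by simp
  qed
  have bound: "cmod (?S N \<theta>) \<le> ?M" for N \<theta>
  proof -
    have "cmod (?S N \<theta>) \<le> (\<Sum>n<N. cmod (c n * of_real r ^ n))"
      by (rule sum_norm_le) (simp add: norm_mult norm_power)
    also have "\<dots> \<le> ?M"
      by (rule sum_le_suminf[OF summable]) auto
    finally show ?thesis .
  qed
  have "(\<lambda>N. integral {0..2*pi} (\<lambda>\<theta>. (cmod (?S N \<theta>))\<^sup>2))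
     \<longlonglongrightarrow> integral {0..2*pi} (\<lambda>\<theta>. (cmod (f (of_real r * cis \<theta>)))\<^sup>2)"
  proof (rule dominated_convergence)
    show "(\<lambda>\<theta>. (cmod (?S N \<theta>))\<^sup>2) integrable_on {0..2*pi}" for N
      using parseval_trigonometric_polynomial by blast
    show "(\<lambda>\<theta>. ?M\<^sup>2) integrable_on {0..2*pi}"
      by (rule integrable_const_ivl)
    show "norm ((cmod (?S N \<theta>))\<^sup>2) \<le> ?M\<^sup>2" for N \<theta>
      using power_mono[OF bound norm_ge_zero, of \<theta> N 2] by simp
    show "(\<lambda>N. (cmod (?S N \<theta>))\<^sup>2) \<longlonglongrightarrow> (cmod (f (of_real r * cis \<theta>)))\<^sup>2" for \<theta>
      using f[of "of_real r * cis \<theta>"] r unfolding sums_def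
      by (intro tendsto_intros) (auto simp: norm_mult)
  qed
  then have "(\<lambda>N. 1 / (2 * pi) * (2 * pi * (\<Sum>n<N. (cmod (c n))\<^sup>2 * r ^ (2 * n)))) \<longlonglongrightarrow> circle_mean f r"
    unfolding circle_mean_def integral_unique[OF parseval_trigonometric_polynomial]
    by (rule tendsto_mult_left)
  then show ?thesis
    by (simp add: sums_def)
qed

lemma parseval_taylor:
  assumes "f holomorphic_on ball 0 1" "0 \<le> r" "r < 1"
  shows "(\<lambda>n. (cmod (taylor_coeff f n))\<^sup>2 * r ^ (2 * n)) sums circle_mean f r"
  using assms by (intro parseval_circle taylor_sums) auto

lemma square_integrable_circle:
  assumes "f holomorphic_on ball 0 1" "0 \<le> r" "r < 1"
  shows "(\<lambda>\<theta>. (cmod (f (of_real r * cis \<theta>)))\<^sup>2) integrable_on {0..2*pi}"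
proof -
  have "continuous_on {0..2*pi} (\<lambda>\<theta>. f (of_real r * cis \<theta>))"
    using assms
    by (intro continuous_on_compose2[OF holomorphic_on_imp_continuous_on[OF assms(1)]] continuous_intros)
       (auto simp: norm_mult)
  then show ?thesis
    by (intro integrable_continuous_real continuous_intros)
qed

section \<open>Estimates for the Hardy norm\<close>

text \<open>
  By Parseval the mean is \<open>\<Sum>n. \<bar>b\<bar>^(2n) r^(2n)\<close>, a series dominated by the one for \<open>\<bar>b\<bar> = 1\<close>.
\<close>

lemma circle_mean_Cauchy_kernel:
  assumes "cmod b \<le> 1" "0 \<le> r" "r < 1"
  shows "circle_mean (\<lambda>z. 1 / (1 - b * z)) r \<le> 1 / (1 - r\<^sup>2)"
proof -
  have "(\<lambda>n. (cmod (b ^ n))\<^sup>2 * r ^ (2 * n)) sums circle_mean (\<lambda>z. 1 / (1 - b * z)) r"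
  proof (rule parseval_circle)
    fix z :: complex assume "cmod z < 1"
    then have "cmod (b * z) < 1"
      using mult_mono[of "cmod b" 1 "cmod z" "cmod z"] assms by (simp add: norm_mult)
    from geometric_sums[OF this] show "(\<lambda>n. b ^ n * z ^ n) sums (1 / (1 - b * z))"
      by (simp add: power_mult_distrib)
  qed (use assms in auto)
  moreover have "(\<lambda>n. (r\<^sup>2) ^ n) sums (1 / (1 - r\<^sup>2))"
    using assms by (intro geometric_sums) (simp add: power_less_one_iff abs_square_less_1)
  moreover have "(cmod (b ^ n))\<^sup>2 * r ^ (2 * n) \<le> (r\<^sup>2) ^ n" for n
  proof -
    have "(cmod (b ^ n))\<^sup>2 \<le> 1"
      using assms(1) by (simp add: norm_power power_le_one)
    then show ?thesis
      using assms(2) by (simp add: mult_left_le_one_le power_mult)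
  qed
  ultimately show ?thesis
    by (meson sums_le)
qed

lemma hardy2_norm_leI:
  assumes "\<And>r. 0 < r \<Longrightarrow> r < 1 \<Longrightarrow> circle_mean f r \<le> B\<^sup>2" "0 \<le> B"
  shows "hardy2_norm f \<le> ennreal B"
  unfolding hardy2_norm_def circle_mean_def[symmetric]
  using assms by (intro SUP_least ennreal_leI real_le_lsqrt) (auto simp: real_le_lsqrt)

text \<open>
  With \<open>a n\<close> the squared moduli of the Taylor coefficients of \<open>h\<close> and \<open>u = r\<^sup>2\<close>, the hypothesis says
  \<open>(1 - u) * (\<Sum>n. (n + 1)\<^sup>2 * a (n + 1) * u^n) \<le> K\<close>.  Integrating this over \<open>0 < u < 1\<close> turns the
  factor \<open>(n + 1)\<^sup>2\<close> into \<open>(n + 1) / (n + 2) \<ge> 1 / 2\<close>, which leaves \<open>\<Sum>n. a (n + 1) \<le> 2 * K\<close>.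
  This is the Littlewood-Paley estimate with weight \<open>1 - r\<^sup>2\<close>, read off coefficientwise.
\<close>

lemma hardy2_norm_le_of_deriv:
  assumes h: "h holomorphic_on ball 0 1" "h 0 = 0"
    and K: "\<And>r. 0 < r \<Longrightarrow> r < 1 \<Longrightarrow> circle_mean (deriv h) r \<le> K / (1 - r\<^sup>2)" "0 \<le> K"
  shows "hardy2_norm h \<le> ennreal (sqrt (2 * K))"
proof (rule hardy2_norm_leI)
  define a where "a n = (cmod (taylor_coeff h n))\<^sup>2" for n
  have hol': "deriv h holomorphic_on ball 0 1"
    using h(1) by (intro holomorphic_deriv) auto
  have deriv_sum: "(\<Sum>n<N. (real (Suc n))\<^sup>2 * a (Suc n) * u ^ n) * (1 - u) \<le> K" if u: "0 < u" "u < 1" for N u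
  proof -
    have r: "0 < sqrt u" "sqrt u < 1" using u by auto
    have pw: "sqrt u ^ (2 * n) = u ^ n" for n
      using u by (simp add: power_mult)
    have coeff: "(cmod (taylor_coeff (deriv h) n))\<^sup>2 = (real (Suc n))\<^sup>2 * a (Suc n)" for n
      unfolding taylor_coeff_deriv a_def norm_mult norm_of_nat power_mult_distrib ..
    have s: "(\<lambda>n. (real (Suc n))\<^sup>2 * a (Suc n) * u ^ n) sums circle_mean (deriv h) (sqrt u)"
      using parseval_taylor[OF hol' less_imp_le[OF r(1)] r(2)] unfolding coeff pw .
    have "(\<Sum>n<N. (real (Suc n))\<^sup>2 * a (Suc n) * u ^ n) \<le> circle_mean (deriv h) (sqrt u)"
      unfolding sums_unique[OF s] using u
      by (intro sum_le_suminf sums_summable[OF s]) (auto simp: a_def)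
    also have "\<dots> \<le> K / (1 - u)"
      using K(1)[OF r] u by simp
    finally show ?thesis
      using u by (simp add: pos_le_divide_eq)
  qed
  have partial: "(\<Sum>n<N. a (Suc n)) \<le> 2 * K" for N
  proof -
    \<comment> \<open>A primitive of the partial sum times \<open>1 - u\<close>; the mean value theorem replaces the integral.\<close>
    define P where "P u = (\<Sum>n<N. (real (Suc n))\<^sup>2 * a (Suc n) * (u ^ Suc n / real (Suc n) - u ^ Suc (Suc n) / real (Suc (Suc n))))" for u
    have D: "(P has_real_derivative (\<Sum>n<N. (real (Suc n))\<^sup>2 * a (Suc n) * u ^ n) * (1 - u)) (at u)" for u
    proof -
      have "((\<lambda>u. u ^ Suc k / real (Suc k)) has_real_derivative u ^ k) (at u)" for k
        using DERIV_cdivide[OF DERIV_pow[of "Suc k" u], of "real (Suc k)"]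
        by (simp del: of_nat_Suc power_Suc)
      then have "(P has_real_derivative (\<Sum>n<N. (real (Suc n))\<^sup>2 * a (Suc n) * (u ^ n - u ^ Suc n))) (at u)"
        unfolding P_def by (intro DERIV_sum DERIV_cmult DERIV_diff)
      moreover have "(\<Sum>n<N. (real (Suc n))\<^sup>2 * a (Suc n) * (u ^ n - u ^ Suc n))
          = (\<Sum>n<N. (real (Suc n))\<^sup>2 * a (Suc n) * u ^ n) * (1 - u)"
        unfolding sum_distrib_right by (intro sum.cong refl) (simp add: algebra_simps)
      ultimately show ?thesis by simp
    qed
    obtain u where u: "0 < u" "u < 1"
      and "P 1 - P 0 = (1 - 0) * ((\<Sum>n<N. (real (Suc n))\<^sup>2 * a (Suc n) * u ^ n) * (1 - u))"
      using MVT2[of 0 1 P, OF _ D] by auto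
    moreover have "P 0 = 0" by (simp add: P_def)
    ultimately have "P 1 \<le> K"
      using deriv_sum[OF u, of N] by (simp only: diff_zero mult_1_left)
    moreover have "(\<Sum>n<N. a (Suc n)) / 2 \<le> P 1"
      unfolding sum_divide_distrib P_def
    proof (rule sum_mono)
      fix n
      have "1 / 2 \<le> (real (Suc n))\<^sup>2 * (1 / real (Suc n) - 1 / real (Suc (Suc n)))"
        by (simp add: divide_simps power2_eq_square)
      from mult_left_mono[OF this, of "a (Suc n)"]
      show "a (Suc n) / 2 \<le> (real (Suc n))\<^sup>2 * a (Suc n) * (1 ^ Suc n / real (Suc n) - 1 ^ Suc (Suc n) / real (Suc (Suc n)))"
        by (simp add: a_def mult_ac del: of_nat_Suc)
    qed
    ultimately show ?thesis by simp
  qed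
  have "a 0 = 0"
    using h(2) by (simp add: a_def taylor_coeff_def)
  show "circle_mean h r \<le> (sqrt (2 * K))\<^sup>2" if "0 < r" "r < 1" for r
  proof (rule LIMSEQ_le_const2)
    show "(\<lambda>N. \<Sum>n<Suc N. a n * r ^ (2 * n)) \<longlonglongrightarrow> circle_mean h r"
      using parseval_taylor[OF h(1), of r] that unfolding sums_def a_def
      by (intro LIMSEQ_Suc) auto
    have "(\<Sum>n<Suc N. a n * r ^ (2 * n)) \<le> (sqrt (2 * K))\<^sup>2" for N
    proof -
      have "(\<Sum>n<Suc N. a n * r ^ (2 * n)) \<le> (\<Sum>n<Suc N. a n)"
        using that by (intro sum_mono mult_right_le_one_le) (auto simp: a_def power_le_one)
      also have "\<dots> = (\<Sum>n<N. a (Suc n))"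
        using \<open>a 0 = 0\<close> by (simp only: sum.lessThan_Suc_shift)
      finally show ?thesis
        using partial[of N] K(2) by simp
    qed
    then show "\<exists>N0. \<forall>N\<ge>N0. (\<Sum>n<Suc N. a n * r ^ (2 * n)) \<le> (sqrt (2 * K))\<^sup>2"
      by blast
  qed
qed (use K in auto)

text \<open>
  One term of the Parseval sum gives the bound up to the factor \<open>r\<close>; then \<open>r\<close> tends to 1.
\<close>

lemma first_taylor_coeff_le_hardy2_norm:
  assumes "h holomorphic_on ball 0 1"
  shows "ennreal (cmod (deriv h 0)) \<le> hardy2_norm h"
proof (cases "hardy2_norm h")
  case (real B)
  have "r * cmod (deriv h 0) \<le> B" if r: "0 < r" "r < 1" for r
  proof -
    have s: "(\<lambda>n. (cmod (taylor_coeff h n))\<^sup>2 * r ^ (2 * n)) sums circle_mean h r"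
      using assms r by (intro parseval_taylor) auto
    have "(\<Sum>n\<in>{1}. (cmod (taylor_coeff h n))\<^sup>2 * r ^ (2 * n)) \<le> circle_mean h r"
      unfolding sums_unique[OF s] by (rule sum_le_suminf[OF sums_summable[OF s]]) (use r in auto)
    then have "(r * cmod (deriv h 0))\<^sup>2 \<le> circle_mean h r"
      by (simp add: taylor_coeff_def power_mult_distrib mult_ac)
    then have "r * cmod (deriv h 0) \<le> sqrt (circle_mean h r)"
      by (rule real_le_rsqrt)
    moreover have "ennreal (sqrt (circle_mean h r)) \<le> ennreal B"
      unfolding real(2)[symmetric] hardy2_norm_def circle_mean_def[symmetric]
      using r by (intro SUP_upper) auto
    then have "sqrt (circle_mean h r) \<le> B"
      using real(1) ennreal_le_iff by blast
    ultimately show ?thesis by simp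
  qed
  then have "cmod (deriv h 0) \<le> B"
    by (rule field_le_mult_one_interval)
  then show ?thesis
    unfolding real by (rule ennreal_leI)
qed auto

section \<open>Disc automorphisms, and BMOA inside the Bloch space\<close>

lemma one_minus_mult_in_disc:
  assumes "cmod a \<le> 1" "cmod z < 1"
  shows "1 - a * z \<noteq> 0" "cmod (a * z) < 1"
proof -
  have "cmod (a * z) \<le> 1 * cmod z"
    unfolding norm_mult using assms by (intro mult_right_mono) auto
  then show "cmod (a * z) < 1" using assms by simp
  then show "1 - a * z \<noteq> 0" by auto
qed

lemma disc_aut_0 [simp]: "disc_aut a 0 = a"
  by (simp add: disc_aut_def)

lemma one_minus_norm_disc_aut:
  assumes "cmod a < 1" "cmod z < 1"
  shows "1 - (cmod (disc_aut a z))\<^sup>2 = (1 - (cmod a)\<^sup>2) * (1 - (cmod z)\<^sup>2) / (cmod (1 - cnj a * z))\<^sup>2"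
proof -
  have nz: "1 - cnj a * z \<noteq> 0" using one_minus_mult_in_disc(1)[of "cnj a" z] assms by simp
  have "(cmod (1 - cnj a * z))\<^sup>2 - (cmod (a - z))\<^sup>2 = (1 - (cmod a)\<^sup>2) * (1 - (cmod z)\<^sup>2)"
    unfolding cmod_power2 by (simp add: power2_eq_square algebra_simps)
  then show ?thesis
    using nz by (simp add: disc_aut_def norm_divide power_divide divide_simps)
qed

lemma disc_aut_in_disc:
  assumes "cmod a < 1" "cmod z < 1"
  shows "cmod (disc_aut a z) < 1"
proof -
  have "1 - cnj a * z \<noteq> 0" using one_minus_mult_in_disc(1)[of "cnj a" z] assms by simp
  then have "0 < 1 - (cmod (disc_aut a z))\<^sup>2"
    unfolding one_minus_norm_disc_aut[OF assms] using assms
    by (intro divide_pos_pos mult_pos_pos) (auto simp: abs_square_less_1)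
  then show ?thesis
    by (simp add: abs_square_less_1)
qed

lemma disc_aut_has_derivative:
  assumes "cmod a < 1" "cmod z < 1"
  shows "(disc_aut a has_field_derivative of_real ((cmod a)\<^sup>2 - 1) / (1 - cnj a * z)\<^sup>2) (at z)"
proof -
  have nz: "1 - cnj a * z \<noteq> 0" using one_minus_mult_in_disc(1)[of "cnj a" z] assms by simp
  have "((\<lambda>z. (a - z) / (1 - cnj a * z)) has_field_derivative
      ((- 1) * (1 - cnj a * z) - (a - z) * (- cnj a)) / ((1 - cnj a * z) * (1 - cnj a * z))) (at z)"
    using nz by (auto intro!: derivative_eq_intros)
  moreover have "(- 1) * (1 - cnj a * z) - (a - z) * (- cnj a) = of_real ((cmod a)\<^sup>2 - 1)"
    unfolding of_real_diff complex_norm_square by (simp add: algebra_simps)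
  ultimately show ?thesis
    by (simp only: disc_aut_def[abs_def] power2_eq_square[of "1 - cnj a * z"])
qed

lemma disc_aut_composition:
  assumes f: "f holomorphic_on ball 0 1" and a: "cmod a < 1"
  shows "(\<lambda>z. f (disc_aut a z) - f a) holomorphic_on ball 0 1"
    and "cmod z < 1 \<Longrightarrow> deriv (\<lambda>z. f (disc_aut a z) - f a) z
           = deriv f (disc_aut a z) * (of_real ((cmod a)\<^sup>2 - 1) / (1 - cnj a * z)\<^sup>2)"
proof -
  have D: "((\<lambda>z. f (disc_aut a z) - f a) has_field_derivative
      deriv f (disc_aut a z) * (of_real ((cmod a)\<^sup>2 - 1) / (1 - cnj a * z)\<^sup>2)) (at z)"
    if z: "cmod z < 1" for z
  proof -
    have "(f has_field_derivative deriv f (disc_aut a z)) (at (disc_aut a z))"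
      using disc_aut_in_disc[OF a z] by (intro holomorphic_derivI[OF f]) auto
    from DERIV_diff[OF DERIV_chain2[OF this disc_aut_has_derivative[OF a z]] DERIV_const[of "f a"]]
    show ?thesis by simp
  qed
  then show "(\<lambda>z. f (disc_aut a z) - f a) holomorphic_on ball 0 1"
    unfolding holomorphic_on_open[OF open_ball] by (metis mem_ball_0)
  show "cmod z < 1 \<Longrightarrow> deriv (\<lambda>z. f (disc_aut a z) - f a) z
           = deriv f (disc_aut a z) * (of_real ((cmod a)\<^sup>2 - 1) / (1 - cnj a * z)\<^sup>2)"
    by (intro DERIV_imp_deriv D)
qed

text \<open>
  The quantity \<open>(1 - \<bar>a\<bar>\<^sup>2) * \<bar>f' a\<bar>\<close> is the modulus of the derivative at 0, that is of the first
  Taylor coefficient, of \<open>f \<circ> \<phi>\<^sub>a - f a\<close>, hence at most the Hardy norm of that function.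
\<close>

lemma bloch_norm_le_bmoa_norm:
  assumes f: "f holomorphic_on ball 0 1"
  shows "bloch_norm f \<le> bmoa_norm f"
  unfolding bloch_norm_def bmoa_norm_def
proof (intro add_left_mono SUP_mono)
  fix a :: complex assume a: "a \<in> ball 0 1"
  let ?h = "\<lambda>z. f (disc_aut a z) - f a"
  have a': "cmod a < 1" using a by simp
  have "cmod (deriv ?h 0) = (1 - (cmod a)\<^sup>2) * cmod (deriv f a)"
  proof -
    have "cmod (of_real ((cmod a)\<^sup>2 - 1)) = 1 - (cmod a)\<^sup>2"
      unfolding norm_of_real using a' by (simp add: abs_square_le_1)
    then show ?thesis
      unfolding disc_aut_composition(2)[OF f a', of 0, simplified norm_zero, OF zero_less_one]
      by (simp add: norm_mult del: of_real_diff)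
  qed
  then have "ennreal ((1 - (cmod a)\<^sup>2) * cmod (deriv f a)) \<le> hardy2_norm ?h"
    using first_taylor_coeff_le_hardy2_norm[OF disc_aut_composition(1)[OF f a']] by simp
  then show "\<exists>b\<in>ball 0 1. ennreal ((1 - (cmod a)\<^sup>2) * cmod (deriv f a))
      \<le> hardy2_norm (\<lambda>z. f (disc_aut b z) - f b)"
    using a by blast
qed

lemma BMOA_subset_Bloch: "BMOA \<subseteq> Bloch"
  using bloch_norm_le_bmoa_norm unfolding BMOA_def Bloch_def by (auto intro: le_less_trans)

section \<open>A sufficient condition for BMOA\<close>

text \<open>
  The hypothesis compares \<open>F\<close> with \<open>log (1 / (1 - z))\<close>, and this comparison survives composition with
  \<open>\<phi>\<^sub>a\<close>.  Since \<open>1 - \<phi>\<^sub>a z = (1 - a) * (1 + \<omega> * z) / (1 - cnj a * z)\<close> with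
  \<open>\<omega> = (1 - cnj a) / (1 - a)\<close> of modulus 1, the logarithm becomes, up to a constant,
  \<open>log (1 - cnj a * z) - log (1 + \<omega> * z)\<close>, whose derivative combines two Cauchy kernels with
  parameters in the closed disc and coefficients of modulus at most 1.  Their means on the circle of radius \<open>r\<close> are at most
  \<open>1 / (1 - r\<^sup>2)\<close>, whatever \<open>a\<close> is, which is the growth that bounds the Hardy norm.
\<close>

lemma hardy2_norm_composition_le:
  assumes F: "F holomorphic_on ball 0 1" and a: "cmod a < 1" and "0 \<le> C"
    and bound: "\<And>z. cmod z < 1 \<Longrightarrow> cmod (deriv F z) \<le> C / cmod (1 - z)"
  shows "hardy2_norm (\<lambda>z. F (disc_aut a z) - F a) \<le> ennreal (sqrt 8 * C)"
proof -
  let ?h = "\<lambda>z. F (disc_aut a z) - F a"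
  note hol = disc_aut_composition(1)[OF F a]
  define \<omega> where "\<omega> = (1 - cnj a) / (1 - a)"
  have a1: "1 - a \<noteq> 0" using a by auto
  have norm_\<omega>: "cmod \<omega> = 1"
  proof -
    have "cmod (1 - cnj a) = cmod (cnj (1 - a))" by simp
    then show ?thesis
      unfolding complex_mod_cnj \<omega>_def norm_divide using a1 by simp
  qed
  let ?k1 = "\<lambda>z. 1 / (1 - cnj a * z)" and ?k2 = "\<lambda>z. 1 / (1 - (- \<omega>) * z)"
  have deriv_bound: "cmod (deriv ?h z) \<le> C * (cmod (?k1 z) + cmod (?k2 z))" if z: "cmod z < 1" for z
  proof -
    have nz: "1 - cnj a * z \<noteq> 0" "1 - (- \<omega>) * z \<noteq> 0"
      using one_minus_mult_in_disc(1)[of "cnj a" z] one_minus_mult_in_disc(1)[of "- \<omega>" z] a z norm_\<omega> by auto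
    have one_minus: "1 - disc_aut a z = (1 - a) * (1 - (- \<omega>) * z) / (1 - cnj a * z)"
      using nz a1 by (simp add: disc_aut_def \<omega>_def divide_simps) (simp add: algebra_simps)
    have quotient: "C / cmod p * cmod x = C * cmod (x / p)" for p x
      by (simp add: norm_divide)
    \<comment> \<open>The bound for \<open>deriv ?h\<close> is \<open>C\<close> times the modulus of the derivative of \<open>log (1 - cnj a * z) - log (1 + \<omega> * z)\<close>.\<close>
    have "cmod (deriv F (disc_aut a z)) \<le> C / cmod ((1 - a) * (1 - (- \<omega>) * z) / (1 - cnj a * z))"
      using bound[OF disc_aut_in_disc[OF a z]] unfolding one_minus .
    then have "cmod (deriv ?h z) \<le> C / cmod ((1 - a) * (1 - (- \<omega>) * z) / (1 - cnj a * z))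
        * cmod (of_real ((cmod a)\<^sup>2 - 1) / (1 - cnj a * z)\<^sup>2)"
      unfolding disc_aut_composition(2)[OF F a z] norm_mult[of "deriv F _"] by (rule mult_right_mono) simp
    also have "C / cmod ((1 - a) * (1 - (- \<omega>) * z) / (1 - cnj a * z))
        * cmod (of_real ((cmod a)\<^sup>2 - 1) / (1 - cnj a * z)\<^sup>2) = C * cmod (of_real ((cmod a)\<^sup>2 - 1) / (1 - cnj a * z)\<^sup>2
        / ((1 - a) * (1 - (- \<omega>) * z) / (1 - cnj a * z)))"
      by (simp only: quotient)
    also have "of_real ((cmod a)\<^sup>2 - 1) / (1 - cnj a * z)\<^sup>2 / ((1 - a) * (1 - (- \<omega>) * z) / (1 - cnj a * z))
       = - cnj a * ?k1 z - \<omega> * ?k2 z"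
    proof -
      have "- cnj a * ?k1 z - \<omega> * ?k2 z = (- cnj a - \<omega>) / ((1 - cnj a * z) * (1 - (- \<omega>) * z))"
        using nz by (simp add: divide_simps) (simp add: algebra_simps)
      \<comment> \<open>Partial fractions: the numerator is independent of \<open>z\<close>.\<close>
      also have "- cnj a - \<omega> = of_real ((cmod a)\<^sup>2 - 1) / (1 - a)"
        unfolding \<omega>_def of_real_diff complex_norm_square using a1 by (simp add: divide_simps algebra_simps)
      finally show ?thesis
        using nz a1 by (simp add: power2_eq_square)
    qed
    also have "cmod (- cnj a * ?k1 z - \<omega> * ?k2 z) \<le> cmod (?k1 z) + cmod (?k2 z)"
    proof -
      have "cmod (- cnj a * ?k1 z) \<le> cmod (?k1 z)"
        unfolding norm_mult using a by (intro mult_left_le_one_le) auto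
      moreover have "cmod (\<omega> * ?k2 z) = cmod (?k2 z)"
        unfolding norm_mult norm_\<omega> by simp
      ultimately show ?thesis
        using norm_triangle_ineq4[of "- cnj a * ?k1 z" "\<omega> * ?k2 z"] by linarith
    qed
    finally show ?thesis using \<open>0 \<le> C\<close> by (simp add: mult_left_mono)
  qed
  have hol_k: "?k1 holomorphic_on ball 0 1" "?k2 holomorphic_on ball 0 1"
    using one_minus_mult_in_disc(1)[of "cnj a"] one_minus_mult_in_disc(1)[of "- \<omega>"] a norm_\<omega>
    by (auto intro!: holomorphic_intros)
  have hol': "deriv ?h holomorphic_on ball 0 1"
    using hol by (intro holomorphic_deriv) auto
  have mean: "circle_mean (deriv ?h) r \<le> 4 * C\<^sup>2 / (1 - r\<^sup>2)" if r: "0 < r" "r < 1" for r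
  proof -
    note int = square_integrable_circle[OF _ less_imp_le[OF r(1)] r(2)]
    have "integral {0..2*pi} (\<lambda>\<theta>. (cmod (deriv ?h (of_real r * cis \<theta>)))\<^sup>2)
      \<le> integral {0..2*pi} (\<lambda>\<theta>. 2 * C\<^sup>2 * ((cmod (?k1 (of_real r * cis \<theta>)))\<^sup>2 + (cmod (?k2 (of_real r * cis \<theta>)))\<^sup>2))"
    proof (rule integral_le)
      fix \<theta> :: real
      define w where "w = of_real r * cis \<theta>"
      have w: "cmod w < 1" using r by (simp add: w_def norm_mult)
      have "(cmod (deriv ?h w))\<^sup>2 \<le> (C * (cmod (?k1 w) + cmod (?k2 w)))\<^sup>2"
        by (rule power_mono[OF deriv_bound[OF w]]) simp
      also have "\<dots> \<le> 2 * C\<^sup>2 * ((cmod (?k1 w))\<^sup>2 + (cmod (?k2 w))\<^sup>2)"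
      proof -
        have "(x + y)\<^sup>2 \<le> 2 * (x\<^sup>2 + y\<^sup>2)" for x y :: real
          using sum_squares_bound[of x y] by (simp add: power2_sum)
        from mult_left_mono[OF this, of "C\<^sup>2"] show ?thesis
          by (simp only: power_mult_distrib zero_le_power2 mult_ac)
      qed
      finally show "(cmod (deriv ?h (of_real r * cis \<theta>)))\<^sup>2 \<le> 2 * C\<^sup>2 *
         ((cmod (?k1 (of_real r * cis \<theta>)))\<^sup>2 + (cmod (?k2 (of_real r * cis \<theta>)))\<^sup>2)"
        unfolding w_def .
    qed (rule int[OF hol'], rule integrable_on_mult_right[OF
         Henstock_Kurzweil_Integration.integrable_add[OF int[OF hol_k(1)] int[OF hol_k(2)]]])
    also have "\<dots> = 2 * C\<^sup>2 * (integral {0..2*pi} (\<lambda>\<theta>. (cmod (?k1 (of_real r * cis \<theta>)))\<^sup>2)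
          + integral {0..2*pi} (\<lambda>\<theta>. (cmod (?k2 (of_real r * cis \<theta>)))\<^sup>2))"
      unfolding integral_mult_right
      by (subst Henstock_Kurzweil_Integration.integral_add[OF int[OF hol_k(1)] int[OF hol_k(2)]]) (rule refl)
    finally have "circle_mean (deriv ?h) r \<le> 1 / (2 * pi) * \<dots>"
      unfolding circle_mean_def by (intro mult_left_mono) auto
    also have "\<dots> = 2 * C\<^sup>2 * (circle_mean ?k1 r + circle_mean ?k2 r)"
      unfolding circle_mean_def by (simp only: distrib_left mult_ac)
    also have "\<dots> \<le> 2 * C\<^sup>2 * (1 / (1 - r\<^sup>2) + 1 / (1 - r\<^sup>2))"
      using a norm_\<omega> r
      by (intro mult_left_mono add_mono circle_mean_Cauchy_kernel) auto
    finally show ?thesis by simp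
  qed
  have "hardy2_norm ?h \<le> ennreal (sqrt (2 * (4 * C\<^sup>2)))"
    by (rule hardy2_norm_le_of_deriv[OF hol _ mean]) auto
  moreover have "sqrt (2 * (4 * C\<^sup>2)) = sqrt 8 * C"
    using \<open>0 \<le> C\<close> real_sqrt_mult[of 8 "C\<^sup>2"] by simp
  ultimately show ?thesis by simp
qed

lemma bmoa_norm_le:
  assumes "F holomorphic_on ball 0 1" "0 \<le> C"
    and "\<And>z. cmod z < 1 \<Longrightarrow> cmod (deriv F z) \<le> C / cmod (1 - z)"
  shows "bmoa_norm F \<le> ennreal (cmod (F 0) + sqrt 8 * C)"
proof -
  have "bmoa_norm F \<le> ennreal (cmod (F 0)) + ennreal (sqrt 8 * C)"
    unfolding bmoa_norm_def using assms
    by (intro add_left_mono SUP_least hardy2_norm_composition_le) auto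
  then show ?thesis using assms(2) by (simp add: ennreal_plus)
qed

section \<open>The Cauchy-type operator\<close>

lemma space_borel_measure_on_unit:
  assumes "borel_measure_on_unit M"
  shows "space M = {0..<1}"
  using sets_eq_imp_space_eq[of M "restrict_space borel {0..<1}"] assms
  by (simp add: borel_measure_on_unit_def space_restrict_space)

lemma sets_borel_measure_on_unit:
  assumes "borel_measure_on_unit M" "0 \<le> s"
  shows "{s..<1} \<in> sets M"
  using assms by (auto simp: borel_measure_on_unit_def sets_restrict_space_iff)

lemma borel_measurable_continuous_on_unit:
  assumes "borel_measure_on_unit M" "continuous_on {0..<1} g"
  shows "g \<in> borel_measurable M"
  using borel_measurable_continuous_on_restrict[OF assms(2)] assms(1)
  unfolding borel_measure_on_unit_def by (simp cong: measurable_cong_sets)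

text \<open>
  For the third bound, moving \<open>t\<close> to 1 changes \<open>1 - t * z\<close> by at most \<open>1 - t\<close>, which is itself at
  most \<open>\<bar>1 - t * z\<bar>\<close>.
\<close>

lemma norm_one_minus_ge:
  assumes "0 \<le> t" "t < 1" "cmod z < 1"
  shows "1 - cmod z \<le> cmod (1 - of_real t * z)" "1 - t \<le> cmod (1 - of_real t * z)"
    "cmod (1 - z) / 2 \<le> cmod (1 - of_real t * z)" "1 - of_real t * z \<noteq> 0"
proof -
  have 0: "1 - cmod (of_real t * z) \<le> cmod (1 - of_real t * z)"
    using norm_triangle_ineq2[of 1 "of_real t * z"] by simp
  have "cmod (of_real t * z) \<le> cmod z" "cmod (of_real t * z) \<le> t"
    using assms by (auto simp: norm_mult mult_left_le_one_le mult_left_le)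
  with 0 show 1: "1 - cmod z \<le> cmod (1 - of_real t * z)" and 2: "1 - t \<le> cmod (1 - of_real t * z)"
    by linarith+
  have "cmod (1 - z) = cmod ((1 - of_real t * z) - of_real (1 - t) * z)"
    by (simp add: algebra_simps)
  also have "\<dots> \<le> cmod (1 - of_real t * z) + cmod (of_real (1 - t) * z)"
    by (rule norm_triangle_ineq4)
  also have "cmod (of_real (1 - t) * z) \<le> 1 - t"
    unfolding norm_mult norm_of_real using assms by (simp add: mult_left_le)
  finally show "cmod (1 - z) / 2 \<le> cmod (1 - of_real t * z)"
    using 2 by linarith
  show "1 - of_real t * z \<noteq> 0"
    using 1 assms by auto
qed

lemma integrable_times_bounded_continuous:
  fixes g k :: "real \<Rightarrow> complex"
  assumes M: "borel_measure_on_unit M" and g: "integrable M g"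
    and k: "continuous_on {0..<1} k" "\<And>t. 0 \<le> t \<Longrightarrow> t < 1 \<Longrightarrow> cmod (k t) \<le> B"
  shows "integrable M (\<lambda>t. g t * k t)"
proof (rule Bochner_Integration.integrable_bound)
  show "integrable M (\<lambda>t. of_real B * g t)" using g by simp
  have "k \<in> borel_measurable M"
    by (rule borel_measurable_continuous_on_unit[OF M k(1)])
  then show "(\<lambda>t. g t * k t) \<in> borel_measurable M"
    using g by simp
  have "cmod (g t * k t) \<le> cmod (of_real B * g t)" if "t \<in> space M" for t
  proof -
    have "cmod (k t) \<le> \<bar>B\<bar>"
      using k(2)[of t] that by (simp add: space_borel_measure_on_unit[OF M])
    then show ?thesis
      using mult_right_mono[of "cmod (k t)" "\<bar>B\<bar>" "cmod (g t)"] by (simp add: norm_mult mult.commute)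
  qed
  then show "AE t in M. cmod (g t * k t) \<le> cmod (of_real B * g t)"
    by (rule AE_I2)
qed

lemma integrable_Cauchy_kernel:
  assumes M: "borel_measure_on_unit M" and g: "integrable M (\<lambda>t. f (of_real t))" and z: "cmod z < 1"
  shows "integrable M (\<lambda>t. f (of_real t) / (1 - of_real t * z))"
    and "integrable M (\<lambda>t. f (of_real t) * (of_real t / (1 - of_real t * z)\<^sup>2))"
proof -
  have "integrable M (\<lambda>t. f (of_real t) * (1 / (1 - of_real t * z)))"
  proof (rule integrable_times_bounded_continuous[OF M g])
    show "continuous_on {0..<1} (\<lambda>t::real. 1 / (1 - of_real t * z))"
      by (intro continuous_intros ballI norm_one_minus_ge(4)) (use z in auto)
    show "cmod (1 / (1 - of_real t * z)) \<le> 1 / (1 - cmod z)" if "0 \<le> t" "t < 1" for t :: real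
      using norm_one_minus_ge(1)[OF that z] z unfolding norm_divide norm_one by (intro divide_left_mono mult_pos_pos) auto
  qed
  then show "integrable M (\<lambda>t. f (of_real t) / (1 - of_real t * z))" by simp
  show "integrable M (\<lambda>t. f (of_real t) * (of_real t / (1 - of_real t * z)\<^sup>2))"
  proof (rule integrable_times_bounded_continuous[OF M g])
    show "continuous_on {0..<1} (\<lambda>t::real. of_real t / (1 - of_real t * z)\<^sup>2)"
    proof (intro continuous_intros ballI)
      show "(1 - complex_of_real t * z)\<^sup>2 \<noteq> 0" if "t \<in> {0..<1}" for t
        using norm_one_minus_ge(4)[of t z] that z by simp
    qed
    show "cmod (of_real t / (1 - of_real t * z)\<^sup>2) \<le> 1 / (1 - cmod z)\<^sup>2" if t: "0 \<le> t" "t < 1" for t :: real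
      unfolding norm_divide norm_power
      using norm_one_minus_ge(1)[OF t z] z t by (intro frac_le power_mono) auto
  qed
qed

lemma Cauchy_kernel_difference_quotient:
  fixes a b t w z :: "'a::field"
  assumes "a = 1 - t * w" "b = 1 - t * z" "a \<noteq> 0" "b \<noteq> 0" "w \<noteq> z"
  shows "(1 / a - 1 / b) / (w - z) - t / b\<^sup>2 = t\<^sup>2 * (w - z) / (a * b\<^sup>2)"
proof -
  have diff: "b - a = t * (w - z)" using assms(1,2) by (simp add: right_diff_distrib)
  have "1 / a - 1 / b = (b - a) / (a * b)"
    using assms(3,4) by (simp add: diff_frac_eq)
  then have "(1 / a - 1 / b) / (w - z) = t / (a * b)"
    using assms(5) unfolding diff by simp
  moreover have "t / (a * b) - t / b\<^sup>2 = t * (b - a) / (a * b\<^sup>2)"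
    using assms(3,4) by (simp add: divide_simps power2_eq_square right_diff_distrib)
  ultimately show ?thesis
    unfolding diff by (simp add: power2_eq_square mult.assoc)
qed

text \<open>
  Differentiation under the integral sign.  The difference quotient of the Cauchy kernel differs from
  its derivative by \<open>t\<^sup>2 * (w - z) / ((1 - t * w) * (1 - t * z)\<^sup>2)\<close>, which is \<open>O(\<bar>w - z\<bar>)\<close> uniformly in
  \<open>t\<close> as long as \<open>z\<close> and \<open>w\<close> stay away from the unit circle.
\<close>

lemma I_op_has_field_derivative:
  assumes M: "borel_measure_on_unit M" and g: "integrable M (\<lambda>t. f (of_real t))" and z: "cmod z < 1"
  shows "(I_op M f has_field_derivative
     (LINT t|M. f (of_real t) * (of_real t / (1 - of_real t * z)\<^sup>2))) (at z)"
proof -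
  let ?D = "LINT t|M. f (of_real t) * (of_real t / (1 - of_real t * z)\<^sup>2)"
  define d where "d = (1 - cmod z) / 2"
  have d: "0 < d" using z by (simp add: d_def)
  let ?B = "(LINT t|M. cmod (f (of_real t))) / d ^ 3"
  have est: "cmod ((I_op M f w - I_op M f z) / (w - z) - ?D) \<le> cmod (w - z) * ?B"
    if w: "dist w z < d" "w \<noteq> z" for w
  proof -
    have "cmod w \<le> cmod z + dist w z"
      unfolding dist_norm using norm_triangle_sub[of w z] by simp
    then have w1: "cmod w < 1" "d \<le> 1 - cmod w" and z1: "d \<le> 1 - cmod z"
      using w z by (auto simp: d_def field_simps)
    let ?e = "\<lambda>t. (f (of_real t) / (1 - of_real t * w) - f (of_real t) / (1 - of_real t * z)) / (w - z)
        - f (of_real t) * (of_real t / (1 - of_real t * z)\<^sup>2)"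
    note intgs = integrable_Cauchy_kernel[OF M g w1(1)] integrable_Cauchy_kernel[OF M g z]
    have quotient: "(I_op M f w - I_op M f z) / (w - z) - ?D = (LINT t|M. ?e t)"
      unfolding I_op_def using intgs by simp
    have "cmod (LINT t|M. ?e t) \<le> (LINT t|M. cmod (w - z) / d ^ 3 * cmod (f (of_real t)))"
    proof (rule Bochner_Integration.integral_norm_bound_integral)
      show "integrable M ?e" using intgs by simp
      show "integrable M (\<lambda>t. cmod (w - z) / d ^ 3 * cmod (f (of_real t)))" using g by simp
      fix t assume "t \<in> space M"
      then have t: "0 \<le> t" "t < 1" by (auto simp: space_borel_measure_on_unit[OF M])
      let ?a = "1 - of_real t * w" and ?b = "1 - of_real t * z"
      have nz: "?a \<noteq> 0" "?b \<noteq> 0" "w - z \<noteq> 0"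
        using norm_one_minus_ge(4) t w1(1) z w(2) by auto
      have "(1 / ?a - 1 / ?b) / (w - z) - of_real t / ?b\<^sup>2 = (of_real t)\<^sup>2 * (w - z) / (?a * ?b\<^sup>2)"
        by (rule Cauchy_kernel_difference_quotient) (use nz in auto)
      moreover have "?e t = f (of_real t) * ((1 / ?a - 1 / ?b) / (w - z) - of_real t / ?b\<^sup>2)"
        by (simp add: diff_divide_distrib right_diff_distrib)
      ultimately have "?e t = f (of_real t) * ((of_real t)\<^sup>2 * (w - z) / (?a * ?b\<^sup>2))"
        by simp
      then have "cmod (?e t) = cmod (f (of_real t)) * (t\<^sup>2 * cmod (w - z) / (cmod ?a * (cmod ?b)\<^sup>2))"
        using t by (simp only: norm_mult norm_divide norm_power norm_of_real abs_of_nonneg)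
      also have "\<dots> \<le> cmod (f (of_real t)) * (cmod (w - z) / d ^ 3)"
      proof (intro mult_left_mono frac_le)
        show "t\<^sup>2 * cmod (w - z) \<le> cmod (w - z)"
          using t by (intro mult_left_le_one_le) (auto simp: power_le_one)
        have "d * d\<^sup>2 \<le> cmod ?a * (cmod ?b)\<^sup>2"
          using norm_one_minus_ge(1)[OF t w1(1)] norm_one_minus_ge(1)[OF t z] w1 z1 d
          by (intro mult_mono power_mono) auto
        then show "d ^ 3 \<le> cmod ?a * (cmod ?b)\<^sup>2"
          by (simp add: power3_eq_cube power2_eq_square mult.assoc)
      qed (use d in auto)
      finally show "cmod (?e t) \<le> cmod (w - z) / d ^ 3 * cmod (f (of_real t))"
        by (simp only: mult.commute)
    qed
    also have "\<dots> = cmod (w - z) * ?B"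
      by simp
    finally show ?thesis unfolding quotient .
  qed
  have "((\<lambda>w. (I_op M f w - I_op M f z) / (w - z) - ?D) \<longlongrightarrow> 0) (at z)"
  proof (rule Lim_null_comparison)
    show "eventually (\<lambda>w. cmod ((I_op M f w - I_op M f z) / (w - z) - ?D) \<le> cmod (w - z) * ?B) (at z)"
      unfolding eventually_at using d est by blast
    show "((\<lambda>w. cmod (w - z) * ?B) \<longlongrightarrow> 0) (at z)"
      using d by (auto intro!: tendsto_eq_intros)
  qed
  then show ?thesis
    unfolding has_field_derivative_iff by (rule LIM_zero_cancel)
qed

lemma I_op_holomorphic:
  assumes "borel_measure_on_unit M" "integrable M (\<lambda>t. f (of_real t))"
  shows "I_op M f holomorphic_on ball 0 1"
  unfolding holomorphic_on_open[OF open_ball]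
  using I_op_has_field_derivative[OF assms] by (metis mem_ball_0)

lemma I_op_0: "I_op M f 0 = (LINT t|M. f (of_real t))"
  by (simp add: I_op_def)

section \<open>Cauchy kernels and Carleson measures\<close>

text \<open>
  Put \<open>\<delta> = \<bar>1 - z\<bar>\<close> and decompose the interval into the dyadic layers where \<open>1 - t\<close> is about
  \<open>2^k * \<delta>\<close>, the first one being \<open>1 - t \<le> \<delta>\<close>.  As \<open>\<bar>1 - t * z\<bar>\<close> is at least \<open>1 - t\<close> and at least \<open>\<delta> / 2\<close>, the integrand is at most
  \<open>4 / (4^k * \<delta>\<^sup>2)\<close> on the layer of index \<open>k\<close>, while the Carleson condition bounds the measure of the
  layer by \<open>C * 2^k * \<delta>\<close>.  The resulting geometric series has sum \<open>8 * C / \<delta>\<close>.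
\<close>

lemma carleson_kernel_bound:
  assumes N: "borel_measure_on_unit N" and C: "0 \<le> C"
    and carleson: "\<And>t. 0 \<le> t \<Longrightarrow> t < 1 \<Longrightarrow> emeasure N {t..<1} \<le> ennreal (C * (1 - t))"
    and z: "cmod z < 1"
  shows "(\<integral>\<^sup>+ t. ennreal (1 / (cmod (1 - of_real t * z))\<^sup>2) \<partial>N) \<le> ennreal (8 * C / cmod (1 - z))"
proof -
  define \<delta> where "\<delta> = cmod (1 - z)"
  have \<delta>: "0 < \<delta>" using z by (auto simp: \<delta>_def)
  \<comment> \<open>The maximum keeps the tail inside the interval once \<open>2^k * \<delta>\<close> exceeds 1.\<close>
  define s where "s k = max 0 (1 - 2 ^ k * \<delta>)" for k :: nat
  define c where "c k = 4 / (\<delta>\<^sup>2 * 4 ^ k)" for k :: nat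
  have c: "0 \<le> c k" for k by (simp add: c_def)
  have s: "0 \<le> s k" "s k < 1" "1 - s k \<le> 2 ^ k * \<delta>" for k
    using \<delta> by (auto simp: s_def)
  have pointwise: "ennreal (1 / (cmod (1 - of_real t * z))\<^sup>2) \<le> (\<Sum>k. ennreal (c k) * indicator {s k..<1} t)"
    if t: "t \<in> space N" for t
  proof -
    have t: "0 \<le> t" "t < 1" using that by (auto simp: space_borel_measure_on_unit[OF N])
    define P where "P k \<longleftrightarrow> 1 - t \<le> 2 ^ k * \<delta>" for k :: nat
    obtain n where "(1 - t) / \<delta> < 2 ^ n"
      using real_arch_pow[of 2 "(1 - t) / \<delta>"] by auto
    then have "P n" using \<delta> by (simp add: P_def field_simps)
    define k where "k = (LEAST k. P k)"
    have k: "P k" unfolding k_def using \<open>P n\<close> by (rule LeastI)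
    have "1 / (cmod (1 - of_real t * z))\<^sup>2 \<le> c k"
    proof (cases k)
      case 0
      have "1 / (cmod (1 - of_real t * z))\<^sup>2 \<le> 1 / (\<delta> / 2)\<^sup>2"
        using norm_one_minus_ge(3)[OF t z] \<delta> unfolding \<delta>_def[symmetric]
        by (intro frac_le power_mono) auto
      then show ?thesis using 0 by (simp add: c_def power_divide)
    next
      case (Suc j)
      have "\<not> P j" using not_less_Least[of j P] Suc by (simp add: k_def)
      then have "2 ^ j * \<delta> \<le> cmod (1 - of_real t * z)"
        using norm_one_minus_ge(2)[OF t z] by (simp add: P_def)
      then have "1 / (cmod (1 - of_real t * z))\<^sup>2 \<le> 1 / (2 ^ j * \<delta>)\<^sup>2"
        using \<delta> by (intro frac_le power_mono) auto
      also have "\<dots> = c k"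
        using power_mult_distrib[of "2::real" 2 j] by (simp add: c_def Suc power_mult_distrib power2_eq_square mult_ac)
      finally show ?thesis .
    qed
    moreover have "t \<in> {s k..<1}" using k t by (simp add: s_def P_def)
    ultimately have "ennreal (1 / (cmod (1 - of_real t * z))\<^sup>2) \<le> (\<Sum>i\<in>{k}. ennreal (c i) * indicator {s i..<1} t)"
      by (simp add: ennreal_leI)
    also have "\<dots> \<le> (\<Sum>i. ennreal (c i) * indicator {s i..<1} t)"
      by (rule sum_le_suminf) auto
    finally show ?thesis .
  qed
  have meas: "{s k..<1} \<in> sets N" for k
    by (rule sets_borel_measure_on_unit[OF N s(1)])
  have "(\<integral>\<^sup>+ t. ennreal (1 / (cmod (1 - of_real t * z))\<^sup>2) \<partial>N)
      \<le> (\<integral>\<^sup>+ t. (\<Sum>k. ennreal (c k) * indicator {s k..<1} t) \<partial>N)"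
    by (rule nn_integral_mono[OF pointwise])
  also have "\<dots> = (\<Sum>k. \<integral>\<^sup>+ t. ennreal (c k) * indicator {s k..<1} t \<partial>N)"
    using meas by (intro nn_integral_suminf) auto
  also have "\<dots> = (\<Sum>k. ennreal (c k) * emeasure N {s k..<1})"
    using meas by (intro suminf_cong nn_integral_cmult_indicator) auto
  also have "\<dots> \<le> (\<Sum>k. ennreal (4 * C / \<delta> * (1 / 2) ^ k))"
  proof (intro suminf_le summableI)
    fix k
    have "ennreal (c k) * emeasure N {s k..<1} \<le> ennreal (c k) * ennreal (C * (2 ^ k * \<delta>))"
      using carleson[OF s(1,2)[of k]] s(3)[of k] C
      by (intro mult_left_mono) (auto intro: order_trans ennreal_leI mult_left_mono)
    also have "\<dots> = ennreal (4 * C / \<delta> * (1 / 2) ^ k)"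
    proof -
      have "c k * (C * (2 ^ k * \<delta>)) = 4 * C / \<delta> * (1 / 2) ^ k"
        using \<delta> power_mult_distrib[of "2::real" 2 k]
        by (simp add: c_def power_one_over power2_eq_square divide_simps)
      then show ?thesis using c[of k] C \<delta> by (simp flip: ennreal_mult)
    qed
    finally show "ennreal (c k) * emeasure N {s k..<1} \<le> ennreal (4 * C / \<delta> * (1 / 2) ^ k)" .
  qed
  also have "\<dots> = ennreal (8 * C / \<delta>)"
  proof (rule suminf_ennreal_eq)
    have "(\<lambda>k. 4 * C / \<delta> * (1 / 2) ^ k) sums (4 * C / \<delta> * (1 / (1 - 1 / 2)))"
      by (intro sums_mult geometric_sums) simp
    then show "(\<lambda>k. 4 * C / \<delta> * (1 / 2) ^ k) sums (8 * C / \<delta>)" by simp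
  qed (use C \<delta> in simp)
  finally show ?thesis unfolding \<delta>_def .
qed

section \<open>The logarithmic weight\<close>

text \<open>
  Integrate \<open>\<bar>f' x\<bar> \<le> B / (1 - x\<^sup>2) \<le> B / (1 - x)\<close> along the segment from 0 to \<open>t\<close>.
\<close>

lemma bloch_growth:
  assumes f: "f holomorphic_on ball 0 1"
    and bound: "\<And>z. cmod z < 1 \<Longrightarrow> (1 - (cmod z)\<^sup>2) * cmod (deriv f z) \<le> B"
    and t: "0 \<le> t" "t < 1"
  shows "cmod (f (of_real t) - f 0) \<le> B * ln (1 / (1 - t))"
proof (cases "t = 0")
  case False
  let ?\<phi> = "\<lambda>x. - B * ln (1 - x)"
  have seg: "complex_of_real x \<in> ball 0 1" if "0 \<le> x" "x \<le> t" for x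
    using that t by simp
  have "cmod (f (of_real t) - f (of_real 0)) \<le> ?\<phi> t - ?\<phi> 0"
  proof (rule differentiable_bound_general[where f = "\<lambda>x. f (of_real x)"])
    show "0 < t" using t False by simp
    show "continuous_on {0..t} (\<lambda>x. f (of_real x))"
      using seg by (intro continuous_on_compose2[OF holomorphic_on_imp_continuous_on[OF f]] continuous_intros) auto
    show "continuous_on {0..t} ?\<phi>"
      using t by (intro continuous_intros) auto
    fix x assume x: "0 < x" "x < t"
    have "(f has_field_derivative deriv f (of_real x)) (at (of_real x))"
      using seg x by (intro holomorphic_derivI[OF f]) auto
    then show "((\<lambda>x. f (of_real x)) has_vector_derivative deriv f (of_real x)) (at x)"
      by (rule has_vector_derivative_real_field)
    have "(?\<phi> has_real_derivative B / (1 - x)) (at x)"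
      using x t by (auto intro!: derivative_eq_intros)
    then show "(?\<phi> has_vector_derivative B / (1 - x)) (at x)"
      by (simp add: has_real_derivative_iff_has_vector_derivative)
    have "(1 - x) * cmod (deriv f (of_real x)) \<le> (1 - x\<^sup>2) * cmod (deriv f (of_real x))"
      using x t by (intro mult_right_mono) (auto simp: power2_eq_square mult_left_le_one_le)
    also have "\<dots> \<le> B"
      using bound[of "of_real x"] x t by simp
    finally show "cmod (deriv f (of_real x)) \<le> B / (1 - x)"
      using x t by (simp add: pos_le_divide_eq mult.commute)
  qed
  then show ?thesis using t by (simp add: ln_div)
qed simp

lemma BlochE:
  assumes "f \<in> Bloch"
  obtains B where "0 \<le> B" "bloch_norm f = ennreal B" "cmod (f 0) \<le> B"
    "\<And>z. cmod z < 1 \<Longrightarrow> (1 - (cmod z)\<^sup>2) * cmod (deriv f z) \<le> B"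
proof (cases "bloch_norm f")
  case (real B)
  have "ennreal (cmod (f 0)) \<le> ennreal B"
    unfolding real(2)[symmetric] bloch_norm_def by simp
  moreover have "ennreal ((1 - (cmod z)\<^sup>2) * cmod (deriv f z)) \<le> ennreal B" if "cmod z < 1" for z
  proof -
    have "ennreal ((1 - (cmod z)\<^sup>2) * cmod (deriv f z))
        \<le> (SUP z\<in>ball 0 1. ennreal ((1 - (cmod z)\<^sup>2) * cmod (deriv f z)))"
      using that by (intro SUP_upper) simp
    then show ?thesis
      unfolding real(2)[symmetric] bloch_norm_def by (simp add: add_increasing)
  qed
  ultimately show ?thesis
    using that[of B] real by (simp add: ennreal_le_iff)
qed (use assms in \<open>simp add: Bloch_def\<close>)

text \<open>
  The weight is bounded below, so it dominates constants; this absorbs the term \<open>\<bar>f 0\<bar>\<close> in the growth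
  estimate for Bloch functions.
\<close>

lemma log_weight_ge:
  assumes "0 \<le> t" "t < (1::real)"
  shows "1 / 2 \<le> ln (2 / (1 - t))"
proof -
  have "ln 2 \<le> ln (2 / (1 - t))"
    using assms by (intro ln_mono) (auto simp: pos_le_divide_eq)
  then show ?thesis using ln2_ge_two_thirds by linarith
qed

lemma Bloch_le_log_weight:
  assumes "f \<in> Bloch" "bloch_norm f = ennreal B" "0 \<le> B" and t: "0 \<le> t" "t < 1"
  shows "cmod (f (of_real t)) \<le> 2 * B * ln (2 / (1 - t))"
proof -
  obtain B' where B': "0 \<le> B'" "bloch_norm f = ennreal B'" "cmod (f 0) \<le> B'"
    "\<And>z. cmod z < 1 \<Longrightarrow> (1 - (cmod z)\<^sup>2) * cmod (deriv f z) \<le> B'"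
    by (rule BlochE[OF assms(1)]) blast
  have [simp]: "B' = B" using B' assms by simp
  have "cmod (f (of_real t) - f 0) \<le> B * ln (1 / (1 - t))"
    using assms(1) B'(4) t by (intro bloch_growth) (auto simp: Bloch_def)
  moreover have "cmod (f (of_real t)) \<le> cmod (f 0) + cmod (f (of_real t) - f 0)"
    by (rule norm_triangle_sub)
  ultimately have "cmod (f (of_real t)) \<le> B * (1 + ln (1 / (1 - t)))"
    using B'(3) by (simp add: distrib_left)
  also have "\<dots> \<le> B * (2 * ln (2 / (1 - t)))"
    using log_weight_ge[OF t] ln2_ge_two_thirds t assms(3) by (intro mult_left_mono) (simp_all add: ln_div)
  finally show ?thesis
    by (simp add: mult_ac)
qed

text \<open>
  The function \<open>log (2 / (1 - z))\<close>, written with a difference because \<open>Re (1 - z) > 0\<close> makes that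
  branch holomorphic in the disc.  On the interval it coincides with the weight of the theorem, so that
  applying \<open>I_op M\<close> to it integrates the Cauchy kernel against the weighted measure.
\<close>

definition log_fun :: "complex \<Rightarrow> complex" where
  "log_fun z = of_real (ln 2) - Ln (1 - z)"

lemma log_fun_has_derivative:
  assumes "cmod z < 1"
  shows "(log_fun has_field_derivative 1 / (1 - z)) (at z)"
proof -
  have "Re z < 1" using complex_Re_le_cmod[of z] assms by linarith
  then have "1 - z \<notin> \<real>\<^sub>\<le>\<^sub>0" by (auto simp: complex_nonpos_Reals_iff)
  then show ?thesis
    unfolding log_fun_def by (auto intro!: derivative_eq_intros simp: divide_simps)
qed

lemma log_fun_of_real:
  assumes "t < 1"
  shows "log_fun (of_real t) = of_real (ln (2 / (1 - t)))"
proof -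
  have "Ln (1 - of_real t) = of_real (ln (1 - t))"
    using Ln_of_real[of "1 - t"] assms by simp
  then show ?thesis using assms by (simp add: log_fun_def ln_div)
qed

lemma log_fun_BMOA: "log_fun \<in> BMOA"
proof -
  have hol: "log_fun holomorphic_on ball 0 1"
    unfolding holomorphic_on_open[OF open_ball] using log_fun_has_derivative by (metis mem_ball_0)
  have "bmoa_norm log_fun \<le> ennreal (cmod (log_fun 0) + sqrt 8 * 1)"
    using hol by (rule bmoa_norm_le) (auto simp: DERIV_imp_deriv[OF log_fun_has_derivative] norm_divide)
  then show ?thesis
    using hol by (auto simp: BMOA_def intro: le_less_trans)
qed

lemma log_weight_measurable:
  assumes "borel_measure_on_unit M"
  shows "(\<lambda>t. ln (2 / (1 - t))) \<in> borel_measurable M"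
  by (rule borel_measurable_continuous_on_unit[OF assms]) (auto intro!: continuous_intros)

lemma integrable_of_log_weight_bound:
  assumes M: "borel_measure_on_unit M"
    and fin: "(\<integral>\<^sup>+ t. ennreal (ln (2 / (1 - t))) \<partial>M) < \<infinity>"
    and f: "f holomorphic_on ball 0 1"
    and bound: "\<And>t. 0 \<le> t \<Longrightarrow> t < 1 \<Longrightarrow> cmod (f (of_real t)) \<le> A * ln (2 / (1 - t))"
  shows "integrable M (\<lambda>t. f (of_real t))"
proof (rule Bochner_Integration.integrable_bound)
  have nonneg: "0 \<le> ln (2 / (1 - t))" if "t \<in> space M" for t
    using log_weight_ge[of t] that by (simp add: space_borel_measure_on_unit[OF M])
  have "integrable M (\<lambda>t. ln (2 / (1 - t)))"
    by (rule integrableI_nonneg[OF log_weight_measurable[OF M] AE_I2[OF nonneg] fin])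
  then show "integrable M (\<lambda>t. A * ln (2 / (1 - t)))" by simp
  show "(\<lambda>t. f (of_real t)) \<in> borel_measurable M"
    by (intro borel_measurable_continuous_on_unit[OF M]
        continuous_on_compose2[OF holomorphic_on_imp_continuous_on[OF f]] continuous_intros) auto
  show "AE t in M. cmod (f (of_real t)) \<le> norm (A * ln (2 / (1 - t)))"
    using bound by (intro AE_I2) (fastforce simp: space_borel_measure_on_unit[OF M])
qed

section \<open>Boundedness and the Carleson condition\<close>

text \<open>
  With \<open>\<nu>\<close> the weighted measure, \<open>\<bar>(I_op M f)' z\<bar>\<close> is at most \<open>A\<close> times the integral of
  \<open>1 / \<bar>1 - t * z\<bar>\<^sup>2\<close> against \<open>\<nu>\<close>.  By the Carleson condition this is \<open>O(1 / \<bar>1 - z\<bar>)\<close>, which is the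
  sufficient condition for membership in BMOA.
\<close>

lemma bmoa_norm_I_op_le:
  assumes M: "borel_measure_on_unit M"
    and fin: "(\<integral>\<^sup>+ t. ennreal (ln (2 / (1 - t))) \<partial>M) = ennreal m" "0 \<le> m"
    and C: "0 \<le> C" "\<And>t. 0 \<le> t \<Longrightarrow> t < 1 \<Longrightarrow>
        emeasure (density M (\<lambda>t. ennreal (ln (2 / (1 - t))))) {t..<1} \<le> ennreal (C * (1 - t))"
    and f: "f holomorphic_on ball 0 1"
    and bound: "\<And>t. 0 \<le> t \<Longrightarrow> t < 1 \<Longrightarrow> cmod (f (of_real t)) \<le> A * ln (2 / (1 - t))" "0 \<le> A"
  shows "I_op M f holomorphic_on ball 0 1" "bmoa_norm (I_op M f) \<le> ennreal ((m + 8 * sqrt 8 * C) * A)"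
proof -
  let ?L = "\<lambda>t::real. ln (2 / (1 - t))"
  let ?N = "density M (\<lambda>t. ennreal (?L t))"
  have N: "borel_measure_on_unit ?N" using M by (simp add: borel_measure_on_unit_def)
  note [measurable] = log_weight_measurable[OF M]
  have g: "integrable M (\<lambda>t. f (of_real t))"
    using fin by (intro integrable_of_log_weight_bound[OF M _ f bound(1)]) auto
  have unit: "0 \<le> t" "t < 1" if "t \<in> space M" for t
    using that by (auto simp: space_borel_measure_on_unit[OF M])
  show hol: "I_op M f holomorphic_on ball 0 1" by (rule I_op_holomorphic[OF M g])
  have "ennreal (cmod (I_op M f 0)) \<le> (\<integral>\<^sup>+ t. cmod (f (of_real t)) \<partial>M)"
    unfolding I_op_0 by (rule integral_norm_bound_ennreal[OF g])
  also have "\<dots> \<le> (\<integral>\<^sup>+ t. ennreal A * ennreal (?L t) \<partial>M)"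
  proof (rule nn_integral_mono)
    fix t assume "t \<in> space M"
    note t = unit[OF this]
    have "0 \<le> ?L t" using log_weight_ge[OF t] by linarith
    then show "ennreal (cmod (f (of_real t))) \<le> ennreal A * ennreal (?L t)"
      using bound(1)[OF t] bound(2) by (simp add: ennreal_leI flip: ennreal_mult)
  qed
  also have "\<dots> = ennreal (A * m)"
    using fin bound(2) by (subst nn_integral_cmult) (auto simp: ennreal_mult)
  finally have at_0: "cmod (I_op M f 0) \<le> A * m"
    using bound(2) fin(2) by (subst (asm) ennreal_le_iff) auto
  have deriv_bound: "cmod (deriv (I_op M f) z) \<le> A * 8 * C / cmod (1 - z)" if z: "cmod z < 1" for z
  proof -
    let ?k = "\<lambda>t. 1 / (cmod (1 - of_real t * z))\<^sup>2"
    have meas_k [measurable]: "?k \<in> borel_measurable M"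
      by (intro borel_measurable_continuous_on_unit[OF M] continuous_intros ballI)
         (use norm_one_minus_ge(4) z in auto)
    have "deriv (I_op M f) z = (LINT t|M. f (of_real t) * (of_real t / (1 - of_real t * z)\<^sup>2))"
      by (rule DERIV_imp_deriv[OF I_op_has_field_derivative[OF M g z]])
    then have "ennreal (cmod (deriv (I_op M f) z))
        \<le> (\<integral>\<^sup>+ t. cmod (f (of_real t) * (of_real t / (1 - of_real t * z)\<^sup>2)) \<partial>M)"
      using integral_norm_bound_ennreal[OF integrable_Cauchy_kernel(2)[OF M g z]] by simp
    also have "\<dots> \<le> (\<integral>\<^sup>+ t. ennreal A * (ennreal (?L t) * ennreal (?k t)) \<partial>M)"
    proof (rule nn_integral_mono)
      fix t assume "t \<in> space M"
      note t = unit[OF this]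
      have L: "0 \<le> ?L t" using log_weight_ge[OF t] by linarith
      have "cmod (f (of_real t) * (of_real t / (1 - of_real t * z)\<^sup>2)) = cmod (f (of_real t)) * (t * ?k t)"
        using t by (simp add: norm_mult norm_divide norm_power)
      also have "\<dots> \<le> (A * ?L t) * ?k t"
        using t bound(1)[OF t] L bound(2) by (intro mult_mono mult_left_le_one_le) auto
      finally show "ennreal (cmod (f (of_real t) * (of_real t / (1 - of_real t * z)\<^sup>2)))
          \<le> ennreal A * (ennreal (?L t) * ennreal (?k t))"
        using L bound(2) by (simp add: ennreal_leI mult.assoc flip: ennreal_mult)
    qed
    also have "\<dots> = ennreal A * (\<integral>\<^sup>+ t. ennreal (?k t) \<partial>?N)"
      by (simp add: nn_integral_cmult nn_integral_density)
    also have "\<dots> \<le> ennreal A * ennreal (8 * C / cmod (1 - z))"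
      by (intro mult_left_mono carleson_kernel_bound[OF N C z]) auto
    also have "\<dots> = ennreal (A * 8 * C / cmod (1 - z))"
      using bound(2) C(1) by (simp add: mult.assoc flip: ennreal_mult)
    finally show ?thesis
      using bound(2) C(1) by (subst (asm) ennreal_le_iff) auto
  qed
  have "bmoa_norm (I_op M f) \<le> ennreal (cmod (I_op M f 0) + sqrt 8 * (A * 8 * C))"
    by (rule bmoa_norm_le[OF hol _ deriv_bound]) (use bound(2) C(1) in auto)
  also have "\<dots> \<le> ennreal ((m + 8 * sqrt 8 * C) * A)"
    using at_0 by (intro ennreal_leI) (simp add: algebra_simps)
  finally show "bmoa_norm (I_op M f) \<le> ennreal ((m + 8 * sqrt 8 * C) * A)" .
qed

text \<open>
  For \<open>f = log_fun\<close> the derivative of \<open>I_op M f\<close> at \<open>x\<close> is the integral of \<open>t / (1 - t * x)\<^sup>2\<close> against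
  the weighted measure.  The integrand is nonnegative and at least \<open>x / (1 - x\<^sup>2)\<^sup>2\<close> on the tail
  \<open>{x..<1}\<close>, so the Bloch bound \<open>S / (1 - x\<^sup>2)\<close> for the derivative controls the mass of the tail.
  The restriction \<open>x \<ge> 1 / 2\<close> keeps the factor \<open>x\<close> away from 0.
\<close>

lemma log_weight_tail_le:
  assumes M: "borel_measure_on_unit M"
    and fin: "(\<integral>\<^sup>+ t. ennreal (ln (2 / (1 - t))) \<partial>M) < \<infinity>"
    and F: "I_op M log_fun \<in> Bloch" "bloch_norm (I_op M log_fun) = ennreal S" "0 \<le> S"
    and x: "1 / 2 \<le> x" "x < 1"
  shows "emeasure (density M (\<lambda>t. ennreal (ln (2 / (1 - t))))) {x..<1} \<le> ennreal (4 * S * (1 - x))"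
proof -
  let ?L = "\<lambda>t::real. ln (2 / (1 - t))"
  let ?N = "density M (\<lambda>t. ennreal (?L t))"
  let ?q = "\<lambda>t. ?L t * (t / (1 - t * x)\<^sup>2)"
  note [measurable] = log_weight_measurable[OF M] sets_borel_measure_on_unit[OF M]
  have unit: "0 \<le> t" "t < 1" if "t \<in> space M" for t
    using that by (auto simp: space_borel_measure_on_unit[OF M])
  have L: "0 \<le> ?L t" if "t \<in> space M" for t using log_weight_ge[OF unit[OF that]] by linarith
  have cx: "cmod (of_real x) < 1" using x by simp
  have hol: "log_fun holomorphic_on ball 0 1" using log_fun_BMOA by (simp add: BMOA_def)
  have g: "integrable M (\<lambda>t. log_fun (of_real t))"
  proof (rule integrable_of_log_weight_bound[OF M fin hol, of 1])
    fix t :: real assume t: "0 \<le> t" "t < 1"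
    then show "cmod (log_fun (of_real t)) \<le> 1 * ?L t"
      using log_weight_ge[OF t] by (simp add: log_fun_of_real)
  qed
  have kernel: "log_fun (of_real t) * (of_real t / (1 - of_real t * of_real x)\<^sup>2) = of_real (?q t)"
    if "t \<in> space M" for t
    using unit[OF that] by (simp add: log_fun_of_real)
  have intq: "integrable M ?q"
  proof -
    have "integrable M (\<lambda>t. complex_of_real (?q t))"
      by (rule iffD1[OF Bochner_Integration.integrable_cong[OF refl kernel] integrable_Cauchy_kernel(2)[OF M g cx]])
    then show ?thesis by (simp only: complex_of_real_integrable_eq)
  qed
  have "deriv (I_op M log_fun) (of_real x) = (LINT t|M. of_real (?q t))"
    unfolding DERIV_imp_deriv[OF I_op_has_field_derivative[OF M g cx]]
    using kernel by (rule Bochner_Integration.integral_cong[OF refl])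
  then have deriv_eq: "deriv (I_op M log_fun) (of_real x) = of_real (LINT t|M. ?q t)"
    by (simp only: integral_complex_of_real)
  have "(LINT t|M. ?q t) \<le> S / (1 - x\<^sup>2)"
  proof -
    obtain S' where S': "0 \<le> S'" "bloch_norm (I_op M log_fun) = ennreal S'"
      and bound: "\<And>z. cmod z < 1 \<Longrightarrow> (1 - (cmod z)\<^sup>2) * cmod (deriv (I_op M log_fun) z) \<le> S'"
      by (rule BlochE[OF F(1)]) blast
    have "S' = S" using S' F(2,3) by simp
    then have "(1 - x\<^sup>2) * \<bar>LINT t|M. ?q t\<bar> \<le> S"
      using bound[OF cx] unfolding deriv_eq norm_of_real power2_abs by simp
    moreover have "0 < 1 - x\<^sup>2" using x by (simp add: abs_square_less_1)
    ultimately have "\<bar>LINT t|M. ?q t\<bar> \<le> S / (1 - x\<^sup>2)"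
      by (simp only: pos_le_divide_eq mult.commute)
    then show ?thesis
      by (rule order_trans[OF abs_ge_self])
  qed
  moreover have "ennreal (x / (1 - x\<^sup>2)\<^sup>2) * emeasure ?N {x..<1} \<le> ennreal (LINT t|M. ?q t)"
  proof -
    have "ennreal (x / (1 - x\<^sup>2)\<^sup>2) * emeasure ?N {x..<1}
       = (\<integral>\<^sup>+ t. ennreal (x / (1 - x\<^sup>2)\<^sup>2) * (ennreal (?L t) * indicator {x..<1} t) \<partial>M)"
      using x by (subst emeasure_density) (auto simp: nn_integral_cmult)
    also have "\<dots> \<le> (\<integral>\<^sup>+ t. ennreal (?q t) \<partial>M)"
    proof (rule nn_integral_mono)
      fix t assume t: "t \<in> space M"
      show "ennreal (x / (1 - x\<^sup>2)\<^sup>2) * (ennreal (?L t) * indicator {x..<1} t) \<le> ennreal (?q t)"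
      proof (cases "t \<in> {x..<1}")
        case True
        have "0 < 1 - t * x"
          using True x mult_strict_mono[of t 1 x 1] by simp
        moreover have "1 - t * x \<le> 1 - x\<^sup>2"
          using True x by (simp add: power2_eq_square)
        ultimately have "x / (1 - x\<^sup>2)\<^sup>2 \<le> t / (1 - t * x)\<^sup>2"
          using True x by (intro frac_le power_mono) auto
        from mult_left_mono[OF this L[OF t]] have "x / (1 - x\<^sup>2)\<^sup>2 * ?L t \<le> ?q t"
          by (simp only: mult.commute)
        then show ?thesis
          using True x L[OF t] by (simp add: ennreal_leI flip: ennreal_mult)
      qed auto
    qed
    also have "\<dots> = ennreal (LINT t|M. ?q t)"
      using unit L by (intro nn_integral_eq_integral[OF intq] AE_I2 mult_nonneg_nonneg divide_nonneg_nonneg) auto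
    finally show ?thesis .
  qed
  ultimately have main: "ennreal (x / (1 - x\<^sup>2)\<^sup>2) * emeasure ?N {x..<1} \<le> ennreal (S / (1 - x\<^sup>2))"
    by (meson ennreal_leI order_trans)
  let ?y = "1 - x\<^sup>2"
  have y: "0 < ?y" using x by (simp add: abs_square_less_1)
  have "emeasure ?N {x..<1} = ennreal (?y\<^sup>2 / x) * (ennreal (x / ?y\<^sup>2) * emeasure ?N {x..<1})"
  proof -
    have "ennreal (?y\<^sup>2 / x) * ennreal (x / ?y\<^sup>2) = 1"
      using x y by (simp flip: ennreal_mult)
    then show ?thesis by (simp flip: mult.assoc)
  qed
  also have "\<dots> \<le> ennreal (?y\<^sup>2 / x) * ennreal (S / ?y)"
    by (rule mult_left_mono[OF main]) simp
  also have "\<dots> = ennreal (S * (?y / x))"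
    using x y F(3) by (simp add: power2_eq_square flip: ennreal_mult)
  also have "\<dots> \<le> ennreal (S * (4 * (1 - x)))"
  proof (intro ennreal_leI mult_left_mono)
    have "?y = (1 - x) * (1 + x)" by (simp add: power2_eq_square algebra_simps)
    also have "\<dots> \<le> (1 - x) * (4 * x)" using x by (intro mult_left_mono) auto
    finally have "?y \<le> 4 * (1 - x) * x" by (simp only: mult_ac)
    then show "?y / x \<le> 4 * (1 - x)" using x by (simp add: pos_divide_le_eq)
  qed (rule F(3))
  finally show ?thesis by (simp only: mult_ac)
qed

theorem theorem2p2:
  fixes \<mu> :: "real measure"
  assumes "borel_measure_on_unit \<mu>"
    and "(\<integral>\<^sup>+ t. ennreal (ln (2 / (1 - t))) \<partial>\<mu>) < \<infinity>"
  shows "(carleson_measure (density \<mu> (\<lambda>t. ennreal (ln (2 / (1 - t)))))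
            \<longleftrightarrow> bounded_between Bloch bloch_norm BMOA bmoa_norm (I_op \<mu>))
       \<and> (bounded_between Bloch bloch_norm BMOA bmoa_norm (I_op \<mu>)
            \<longleftrightarrow> bounded_between BMOA bmoa_norm BMOA bmoa_norm (I_op \<mu>))"
proof -
  let ?N = "density \<mu> (\<lambda>t. ennreal (ln (2 / (1 - t))))"
  let ?i = "carleson_measure ?N"
  let ?ii = "bounded_between Bloch bloch_norm BMOA bmoa_norm (I_op \<mu>)"
  let ?iii = "bounded_between BMOA bmoa_norm BMOA bmoa_norm (I_op \<mu>)"
  note M = assms(1) and fin = assms(2)
  obtain m where m: "0 \<le> m" "(\<integral>\<^sup>+ t. ennreal (ln (2 / (1 - t))) \<partial>\<mu>) = ennreal m"
    using fin by (cases "\<integral>\<^sup>+ t. ennreal (ln (2 / (1 - t))) \<partial>\<mu>") auto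
  have "?ii" if "?i"
  proof -
    obtain C where C: "0 < C" "\<And>t. 0 \<le> t \<Longrightarrow> t < 1 \<Longrightarrow> emeasure ?N {t..<1} \<le> ennreal (C * (1 - t))"
      using \<open>?i\<close> unfolding carleson_measure_def by auto
    let ?K = "(m + 8 * sqrt 8 * C) * 2"
    have "I_op \<mu> f \<in> BMOA \<and> bmoa_norm (I_op \<mu> f) \<le> ennreal ?K * bloch_norm f" if f: "f \<in> Bloch" for f
    proof -
      obtain B where B: "0 \<le> B" "bloch_norm f = ennreal B"
        by (rule BlochE[OF f]) blast
      have hol: "f holomorphic_on ball 0 1" using f by (simp add: Bloch_def)
      note I = bmoa_norm_I_op_le[OF M m(2,1) less_imp_le[OF C(1)] C(2) hol
          Bloch_le_log_weight[OF f B(2,1)], simplified]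
      have "ennreal ((m + 8 * sqrt 8 * C) * (2 * B)) = ennreal ?K * bloch_norm f"
        unfolding B(2) using B(1) m(1) C(1) by (subst ennreal_mult[symmetric]) (auto simp: mult_ac)
      moreover have "bmoa_norm (I_op \<mu> f) < \<infinity>"
        using le_less_trans[OF I(2) ennreal_less_top] B(1) by simp
      ultimately show ?thesis
        using I B(1) by (simp add: BMOA_def)
    qed
    moreover have "0 \<le> ?K" using m(1) C(1) by simp
    ultimately show ?ii unfolding bounded_between_def by blast
  qed
  moreover have "?iii" if "?ii"
  proof -
    obtain C where "0 \<le> C" and C: "\<forall>f\<in>Bloch. I_op \<mu> f \<in> BMOA \<and> bmoa_norm (I_op \<mu> f) \<le> ennreal C * bloch_norm f"
      using \<open>?ii\<close> unfolding bounded_between_def by blast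
    have "I_op \<mu> f \<in> BMOA \<and> bmoa_norm (I_op \<mu> f) \<le> ennreal C * bmoa_norm f" if f: "f \<in> BMOA" for f
    proof -
      have "bloch_norm f \<le> bmoa_norm f"
        using f by (intro bloch_norm_le_bmoa_norm) (simp add: BMOA_def)
      then show ?thesis
        using C f BMOA_subset_Bloch by (meson mult_left_mono order_trans subsetD zero_le)
    qed
    with \<open>0 \<le> C\<close> show ?iii unfolding bounded_between_def by blast
  qed
  moreover have "?i" if "?iii"
  proof -
    have F: "I_op \<mu> log_fun \<in> Bloch"
      using \<open>?iii\<close> log_fun_BMOA BMOA_subset_Bloch unfolding bounded_between_def by blast
    obtain S where S: "0 \<le> S" "bloch_norm (I_op \<mu> log_fun) = ennreal S"
      by (rule BlochE[OF F]) blast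
    have total: "emeasure ?N {t..<1} \<le> ennreal m" if "0 \<le> t" for t
    proof -
      have "emeasure ?N {t..<1} \<le> emeasure ?N (space ?N)"
        by (rule emeasure_space)
      also have "\<dots> = ennreal m"
        using log_weight_measurable[OF M]
        by (subst emeasure_density) (auto simp flip: m(2) intro!: nn_integral_cong)
      finally show ?thesis .
    qed
    \<comment> \<open>Below \<open>1 / 2\<close> the total mass \<open>m\<close> suffices, because \<open>1 - t > 1 / 2\<close> there.\<close>
    have "emeasure ?N {t..<1} \<le> ennreal ((4 * S + 2 * m + 1) * (1 - t))" if t: "0 \<le> t" "t < 1" for t
    proof (cases "1 / 2 \<le> t")
      case True
      have "4 * S * (1 - t) \<le> (4 * S + 2 * m + 1) * (1 - t)"
        using t m(1) by (intro mult_right_mono) auto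
      then show ?thesis
        using log_weight_tail_le[OF M fin F S(2,1) True t(2)] by (meson ennreal_leI order_trans)
    next
      case False
      have "m = 2 * m * (1 / 2)" by simp
      also have "\<dots> \<le> (4 * S + 2 * m + 1) * (1 - t)"
        using False m(1) S(1) by (intro mult_mono) auto
      finally show ?thesis
        using total[OF t(1)] by (meson ennreal_leI order_trans)
    qed
    moreover have "0 < 4 * S + 2 * m + 1" using S(1) m(1) by linarith
    moreover have "borel_measure_on_unit ?N" using M by (simp add: borel_measure_on_unit_def)
    ultimately show ?i unfolding carleson_measure_def by auto
  qed
  ultimately show ?thesis by blast
qed

end
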